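(* Let $(G,\mu)$ be a measured group and denote by $(B,m)$ and $(\check B,\check m)$ the Poisson boundaries of $(G,\mu)$ and $(G,\check\mu)$ respectively. If $(Y,\eta)$ is any ergodic probability measure preserving $G$-space, then the diagonal $G$-action on $(B\times\check B\times Y,\ m\otimes\check m\otimes\eta)$ is ergodic.
   Context: A measured group $(G,\mu)$ is a countable group $G$ together with a probability measure $\mu$ on $G$ whose support generates $G$ as a semigroup; $\check\mu(g)=\mu(g^{-1})$. A $(G,\mu)$-space is a (standard) Borel probability space $(X,\nu)$ with an action of $G$ by bi-measurable maps, each preserving the measure class of $\nu$, such that $$\int_G\int_X\phi(g^{-1}x)\,d\nu(x)\,d\mu(g)=\int_X\phi\,d\nu\quad\text{for all }\phi\in L^\infty(X,\nu).$$ An action of $G$ preserving the measure class of a probability measure is ergodic if every $G$-invariant measurable set is null or conull. The Poisson boundary of $(G,\mu)$ is an ergodic $(G,\mu)$-space $(B,m)$ for which the Poisson transform $P\phi(g)=\int_B\phi(g^{-1}b)\,dm(b)$, $g\in G$, is an isometric isomorphism of $L^\infty(B,m)$ onto the space (with supremum norm) of all bounded functions $f$ on $G$ satisfying $f(g)=\int_G f(sg)\,d\mu(s)$ for all $g\in G$. The Poisson boundary $(\check B,\check m)$ of $(G,\check\mu)$ is defined in the same way with $\check\mu$ in place of $\mu$. A probability measure preserving $G$-space is a (standard) Borel probability space with a measurable $G$-action preserving the measure. *)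

theory Defs
  imports "HOL-Probability.Probability" "HOL-Algebra.Group_Action"
begin

inductive_set semigroup_generated :: "('g, 'z) monoid_scheme \<Rightarrow> 'g set \<Rightarrow> 'g set"
  for G and S where
  incl: "s \<in> S \<Longrightarrow> s \<in> semigroup_generated G S"
| mult: "a \<in> semigroup_generated G S \<Longrightarrow> b \<in> semigroup_generated G S
          \<Longrightarrow> a \<otimes>\<^bsub>G\<^esub> b \<in> semigroup_generated G S"

text \<open>Since the group is countable, a probability measure on it is a probability mass function
  supported in the carrier.\<close>

definition measured_group :: "('g, 'z) monoid_scheme \<Rightarrow> 'g pmf \<Rightarrow> bool" where
  "measured_group G \<mu> \<longleftrightarrow>
     group G \<and> countable (carrier G) \<and> set_pmf \<mu> \<subseteq> carrier G \<and>
     semigroup_generated G (set_pmf \<mu>) = carrier G"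

definition reflected_pmf :: "('g, 'z) monoid_scheme \<Rightarrow> 'g pmf \<Rightarrow> 'g pmf" where
  "reflected_pmf G \<mu> = map_pmf (\<lambda>g. inv\<^bsub>G\<^esub> g) \<mu>"

lemma pmf_reflected_pmf:
  assumes "measured_group G \<mu>" and g: "g \<in> carrier G"
  shows "pmf (reflected_pmf G \<mu>) g = pmf \<mu> (inv\<^bsub>G\<^esub> g)"
proof -
  interpret group G using assms by (simp add: measured_group_def)
  have sub: "set_pmf \<mu> \<subseteq> carrier G" using assms by (simp add: measured_group_def)
  have "pmf (reflected_pmf G \<mu>) g = measure (measure_pmf \<mu>) ((\<lambda>h. inv\<^bsub>G\<^esub> h) -` {g})"
    by (simp add: reflected_pmf_def pmf_map)
  also have "\<dots> = measure (measure_pmf \<mu>) {inv\<^bsub>G\<^esub> g}"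
    by (rule measure_pmf.finite_measure_eq_AE) (use sub g in \<open>auto intro!: AE_pmfI\<close>)
  finally show ?thesis by (simp add: pmf.rep_eq)
qed

definition standard_borel :: "'x measure \<Rightarrow> bool" where
  "standard_borel M \<longleftrightarrow>
     (\<exists>T. completely_metrizable_space T \<and> separable_space T \<and> topspace T = space M \<and>
          sets M = sigma_sets (topspace T) {U. openin T U})"

text \<open>An action in the sense of \<^locale>\<open>group_action\<close> is a homomorphism into the group of
  bijections of \<^term>\<open>space M\<close>, represented by extensional functions.
  Each map is bi-measurable because the maps of both \<open>g\<close> and its inverse are measurable.\<close>

definition measurable_action ::
    "('g, 'z) monoid_scheme \<Rightarrow> 'x measure \<Rightarrow> ('g \<Rightarrow> 'x \<Rightarrow> 'x) \<Rightarrow> bool" where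
  "measurable_action G M \<alpha> \<longleftrightarrow>
     group_action G (space M) \<alpha> \<and> (\<forall>g\<in>carrier G. \<alpha> g \<in> M \<rightarrow>\<^sub>M M)"

definition measure_class_preserving ::
    "('g, 'z) monoid_scheme \<Rightarrow> 'x measure \<Rightarrow> ('g \<Rightarrow> 'x \<Rightarrow> 'x) \<Rightarrow> bool" where
  "measure_class_preserving G M \<alpha> \<longleftrightarrow>
     measurable_action G M \<alpha> \<and> (\<forall>g\<in>carrier G. null_sets (distr M M (\<alpha> g)) = null_sets M)"

definition measure_preserving_action ::
    "('g, 'z) monoid_scheme \<Rightarrow> 'x measure \<Rightarrow> ('g \<Rightarrow> 'x \<Rightarrow> 'x) \<Rightarrow> bool" where
  "measure_preserving_action G M \<alpha> \<longleftrightarrow>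
     measurable_action G M \<alpha> \<and> (\<forall>g\<in>carrier G. distr M M (\<alpha> g) = M)"

definition ergodic_action ::
    "('g, 'z) monoid_scheme \<Rightarrow> 'x measure \<Rightarrow> ('g \<Rightarrow> 'x \<Rightarrow> 'x) \<Rightarrow> bool" where
  "ergodic_action G M \<alpha> \<longleftrightarrow>
     prob_space M \<and> measure_class_preserving G M \<alpha> \<and>
     (\<forall>A\<in>sets M. (\<forall>g\<in>carrier G. \<alpha> g ` A = A) \<longrightarrow>
        A \<in> null_sets M \<or> space M - A \<in> null_sets M)"

text \<open>Representatives of the classes in \<open>L\<^sup>\<infinity>\<close>; the norm is a seminorm on representatives which
  vanishes exactly on the functions that are zero almost everywhere.\<close>

definition Linfty_norm :: "'x measure \<Rightarrow> ('x \<Rightarrow> real) \<Rightarrow> ereal" where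
  "Linfty_norm M \<phi> = esssup M (\<lambda>x. ereal \<bar>\<phi> x\<bar>)"

definition Linfty :: "'x measure \<Rightarrow> ('x \<Rightarrow> real) set" where
  "Linfty M = {\<phi> \<in> borel_measurable M. Linfty_norm M \<phi> < \<infinity>}"

definition measured_group_space ::
    "('g, 'z) monoid_scheme \<Rightarrow> 'g pmf \<Rightarrow> 'x measure \<Rightarrow> ('g \<Rightarrow> 'x \<Rightarrow> 'x) \<Rightarrow> bool" where
  "measured_group_space G \<mu> M \<alpha> \<longleftrightarrow>
     standard_borel M \<and> prob_space M \<and> measure_class_preserving G M \<alpha> \<and>
     (\<forall>\<phi>\<in>Linfty M.
        (\<integral>g. (\<integral>x. \<phi> (\<alpha> (inv\<^bsub>G\<^esub> g) x) \<partial>M) \<partial>measure_pmf \<mu>) = (\<integral>x. \<phi> x \<partial>M))"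

text \<open>Functions on the group are taken extensional on the carrier, so that equality of functions
  is equality on the carrier.\<close>

definition bounded_harmonic :: "('g, 'z) monoid_scheme \<Rightarrow> 'g pmf \<Rightarrow> ('g \<Rightarrow> real) set" where
  "bounded_harmonic G \<mu> =
     {f \<in> extensional (carrier G). bounded (f ` carrier G) \<and>
        (\<forall>g\<in>carrier G. f g = (\<integral>s. f (s \<otimes>\<^bsub>G\<^esub> g) \<partial>measure_pmf \<mu>))}"

definition sup_norm :: "('g, 'z) monoid_scheme \<Rightarrow> ('g \<Rightarrow> real) \<Rightarrow> ereal" where
  "sup_norm G f = (SUP g\<in>carrier G. ereal \<bar>f g\<bar>)"

definition poisson_transform ::
    "('g, 'z) monoid_scheme \<Rightarrow> 'x measure \<Rightarrow> ('g \<Rightarrow> 'x \<Rightarrow> 'x) \<Rightarrow> ('x \<Rightarrow> real) \<Rightarrow> 'g \<Rightarrow> real" where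
  "poisson_transform G M \<alpha> \<phi> = (\<lambda>g\<in>carrier G. \<integral>b. \<phi> (\<alpha> (inv\<^bsub>G\<^esub> g) b) \<partial>M)"

text \<open>Injectivity on almost everywhere classes is part of the isometry clause, by linearity.\<close>

definition poisson_boundary ::
    "('g, 'z) monoid_scheme \<Rightarrow> 'g pmf \<Rightarrow> 'x measure \<Rightarrow> ('g \<Rightarrow> 'x \<Rightarrow> 'x) \<Rightarrow> bool" where
  "poisson_boundary G \<mu> M \<alpha> \<longleftrightarrow>
     measured_group_space G \<mu> M \<alpha> \<and> ergodic_action G M \<alpha> \<and>
     (\<forall>\<phi>\<in>Linfty M. \<forall>\<psi>\<in>Linfty M. \<forall>a b. \<forall>g\<in>carrier G.
        poisson_transform G M \<alpha> (\<lambda>x. a * \<phi> x + b * \<psi> x) g =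
        a * poisson_transform G M \<alpha> \<phi> g + b * poisson_transform G M \<alpha> \<psi> g) \<and>
     (\<forall>\<phi>\<in>Linfty M. sup_norm G (poisson_transform G M \<alpha> \<phi>) = Linfty_norm M \<phi>) \<and>
     poisson_transform G M \<alpha> ` Linfty M = bounded_harmonic G \<mu>"

definition pmp_space ::
    "('g, 'z) monoid_scheme \<Rightarrow> 'x measure \<Rightarrow> ('g \<Rightarrow> 'x \<Rightarrow> 'x) \<Rightarrow> bool" where
  "pmp_space G M \<alpha> \<longleftrightarrow>
     standard_borel M \<and> prob_space M \<and> measure_preserving_action G M \<alpha>"

definition diagonal_action ::
    "'x measure \<Rightarrow> ('g \<Rightarrow> 'x \<Rightarrow> 'x) \<Rightarrow> 'y measure \<Rightarrow> ('g \<Rightarrow> 'y \<Rightarrow> 'y) \<Rightarrow>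
     'w measure \<Rightarrow> ('g \<Rightarrow> 'w \<Rightarrow> 'w) \<Rightarrow> 'g \<Rightarrow> 'x \<times> 'y \<times> 'w \<Rightarrow> 'x \<times> 'y \<times> 'w" where
  "diagonal_action L \<alpha> M \<beta> N \<gamma> g =
     (\<lambda>(x, y, w)\<in>space L \<times> space M \<times> space N. (\<alpha> g x, \<beta> g y, \<gamma> g w))"

end

theory Submission
  imports Defs
begin

text \<open>Everything rests on one extension principle: if \<open>(B, m)\<close> is the Poisson boundary of
  \<open>(G, \<mu>)\<close>, and \<open>(X, \<xi>)\<close> is an ergodic \<open>G\<close>-space with \<open>\<Sum>g. \<mu>(g) g\<^sub>*\<xi> = \<xi>\<close>, then \<open>B \<times> X\<close> is
  ergodic. Indeed, let \<open>S\<close> be an invariant set and \<open>\<Phi>(x) = m(S\<^sup>x)\<close> the measure of its section.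
  Invariance gives \<open>\<Phi>(g x) = P(1\<^bsub>S\<^sup>x\<^esub>)(g)\<close>, so \<open>\<Sum>g. \<mu>(g) \<Phi>(g x) = \<Phi>(x)\<close>; since \<open>\<xi>\<close> is
  stationary, expanding the square shows that \<open>\<integral>\<Sum>g. \<mu>(g) (\<Phi>(g x) - \<Phi>(x))\<^sup>2 d\<xi>(x)\<close> vanishes and
  \<open>\<Phi>\<close> is almost everywhere invariant. Hence the Poisson transform of \<open>1\<^bsub>S\<^sup>x\<^esub>\<close> is constant, so
  \<open>1\<^bsub>S\<^sup>x\<^esub>\<close> is almost everywhere constant and \<open>\<Phi>\<close> takes only the values 0 and 1; ergodicity of \<open>X\<close>
  finishes the argument. The principle is applied first to the boundary of the reflected measure
  and \<open>Y\<close>, then to the boundary of \<open>\<mu>\<close> and the resulting product.\<close>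

section \<open>Measure theory\<close>

lemma nn_integral_measure_pmf_swap:
  fixes f :: "'i \<Rightarrow> 'x \<Rightarrow> ennreal"
  assumes meas: "\<And>i. i \<in> set_pmf p \<Longrightarrow> f i \<in> borel_measurable M"
  shows "(\<integral>\<^sup>+i. \<integral>\<^sup>+x. f i x \<partial>M \<partial>measure_pmf p) = (\<integral>\<^sup>+x. \<integral>\<^sup>+i. f i x \<partial>measure_pmf p \<partial>M)"
proof -
  have support: "(\<integral>\<^sup>+i. h i \<partial>measure_pmf p) = (\<integral>\<^sup>+i. pmf p i * h i \<partial>count_space (set_pmf p))"
    for h :: "'i \<Rightarrow> ennreal"
    unfolding nn_integral_measure_pmf
    by (rule nn_integral_count_space_eq) (auto simp: set_pmf_iff)
  have "(\<integral>\<^sup>+i. \<integral>\<^sup>+x. f i x \<partial>M \<partial>measure_pmf p) =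
      (\<integral>\<^sup>+i. \<integral>\<^sup>+x. pmf p i * f i x \<partial>M \<partial>count_space (set_pmf p))"
    unfolding support by (intro nn_integral_cong) (simp add: nn_integral_cmult meas)
  also have "\<dots> = (\<integral>\<^sup>+x. \<integral>\<^sup>+i. pmf p i * f i x \<partial>count_space (set_pmf p) \<partial>M)"
    by (rule nn_integral_count_space_nn_integral[symmetric])
      (auto intro: borel_measurable_times_ennreal meas)
  finally show ?thesis by (simp add: support)
qed

lemma nn_integral_measure_pmf_cong:
  "(\<And>i. i \<in> set_pmf p \<Longrightarrow> f i = h i) \<Longrightarrow>
    (\<integral>\<^sup>+i. f i \<partial>measure_pmf p) = (\<integral>\<^sup>+i. h i \<partial>measure_pmf p)"
  by (rule nn_integral_cong_AE) (simp add: AE_measure_pmf_iff)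

lemma nn_integral_mixture_measure_pmf:
  assumes sets: "\<And>i. i \<in> set_pmf p \<Longrightarrow> sets (N i) = sets M"
    and emeasure: "\<And>A. A \<in> sets M \<Longrightarrow> (\<integral>\<^sup>+i. emeasure (N i) A \<partial>measure_pmf p) = emeasure M A"
    and "f \<in> borel_measurable M"
  shows "(\<integral>\<^sup>+i. \<integral>\<^sup>+x. f x \<partial>N i \<partial>measure_pmf p) = (\<integral>\<^sup>+x. f x \<partial>M)"
  using assms(3)
proof induction
  case (cong f h)
  have "(\<integral>\<^sup>+x. f x \<partial>N i) = (\<integral>\<^sup>+x. h x \<partial>N i)" if "i \<in> set_pmf p" for i
    using cong(3) sets_eq_imp_space_eq[OF sets[OF that]] by (intro nn_integral_cong) simp
  moreover have "(\<integral>\<^sup>+x. f x \<partial>M) = (\<integral>\<^sup>+x. h x \<partial>M)"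
    using cong(3) by (rule nn_integral_cong)
  ultimately show ?case using cong(4) by (simp cong: nn_integral_measure_pmf_cong)
next
  case (set A)
  then show ?case by (simp add: sets emeasure cong: nn_integral_measure_pmf_cong)
next
  case (mult f c)
  then show ?case
    by (simp add: nn_integral_cmult sets cong: nn_integral_measure_pmf_cong measurable_cong_sets)
next
  case (add f h)
  then show ?case
    by (simp add: nn_integral_add sets cong: nn_integral_measure_pmf_cong measurable_cong_sets)
next
  case (seq F)
  have "(\<integral>\<^sup>+x. (SUP k. F k x) \<partial>N i) = (SUP k. \<integral>\<^sup>+x. F k x \<partial>N i)" if "i \<in> set_pmf p" for i
    using seq that
    by (intro nn_integral_monotone_convergence_SUP) (simp_all add: sets cong: measurable_cong_sets)
  moreover have "incseq (\<lambda>k i. \<integral>\<^sup>+x. F k x \<partial>N i)"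
    using \<open>incseq F\<close> by (auto simp: incseq_def le_fun_def intro!: nn_integral_mono)
  ultimately show ?case
    using seq by (simp add: nn_integral_monotone_convergence_SUP image_comp
        cong: nn_integral_measure_pmf_cong)
qed

lemma nn_integral_power2_diff:
  fixes f h :: "'x \<Rightarrow> real"
  assumes [measurable]: "f \<in> borel_measurable M" "h \<in> borel_measurable M"
    and nonneg: "\<And>x. 0 \<le> f x" "\<And>x. 0 \<le> h x"
  shows "(\<integral>\<^sup>+x. (f x - h x)\<^sup>2 \<partial>M) + 2 * (\<integral>\<^sup>+x. f x * h x \<partial>M) =
    (\<integral>\<^sup>+x. (f x)\<^sup>2 \<partial>M) + (\<integral>\<^sup>+x. (h x)\<^sup>2 \<partial>M)"
proof -
  have "ennreal ((f x - h x)\<^sup>2) + 2 * ennreal (f x * h x) = ennreal ((f x)\<^sup>2) + ennreal ((h x)\<^sup>2)"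
    for x
  proof -
    have "ennreal ((f x - h x)\<^sup>2) + 2 * ennreal (f x * h x) =
        ennreal ((f x - h x)\<^sup>2 + 2 * (f x * h x))"
      by (simp add: nonneg ennreal_plus ennreal_mult)
    also have "(f x - h x)\<^sup>2 + 2 * (f x * h x) = (f x)\<^sup>2 + (h x)\<^sup>2"
      by (simp add: power2_diff)
    finally show ?thesis by simp
  qed
  then show ?thesis by (simp flip: nn_integral_cmult nn_integral_add)
qed

lemma (in pair_sigma_finite) null_sets_pair_measure_iff2:
  assumes "S \<in> sets (M1 \<Otimes>\<^sub>M M2)"
  shows "S \<in> null_sets (M1 \<Otimes>\<^sub>M M2) \<longleftrightarrow> (AE y in M2. (\<lambda>x. (x, y)) -` S \<in> null_sets M1)"
  using assms
  by (simp add: null_sets_def sets_Pair2 emeasure_pair_measure_alt2 nn_integral_0_iff_AE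
      measurable_emeasure_Pair2)

lemma Linfty_iff_AE_bounded:
  "\<phi> \<in> Linfty M \<longleftrightarrow> \<phi> \<in> borel_measurable M \<and> (\<exists>C. AE x in M. \<bar>\<phi> x\<bar> \<le> C)"
proof safe
  assume "\<phi> \<in> Linfty M"
  then have "Linfty_norm M \<phi> < \<infinity>" by (simp add: Linfty_def)
  then obtain C where "Linfty_norm M \<phi> \<le> ereal C"
    by (cases "Linfty_norm M \<phi>") auto
  moreover have "AE x in M. ereal \<bar>\<phi> x\<bar> \<le> Linfty_norm M \<phi>"
    unfolding Linfty_norm_def by (rule esssup_AE)
  ultimately have "AE x in M. \<bar>\<phi> x\<bar> \<le> C"
    by (auto elim!: eventually_mono dest: order_trans)
  then show "\<exists>C. AE x in M. \<bar>\<phi> x\<bar> \<le> C" ..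
next
  fix C assume "\<phi> \<in> borel_measurable M" "AE x in M. \<bar>\<phi> x\<bar> \<le> C"
  then have "Linfty_norm M \<phi> \<le> ereal C"
    unfolding Linfty_norm_def by (intro esssup_I) auto
  then show "\<phi> \<in> Linfty M" using \<open>\<phi> \<in> borel_measurable M\<close> by (auto simp: Linfty_def)
qed (simp add: Linfty_def)

lemma Linfty_const: "(\<lambda>x. c) \<in> Linfty M"
  by (auto simp: Linfty_iff_AE_bounded)

lemma Linfty_diff:
  assumes "\<phi> \<in> Linfty M" "\<psi> \<in> Linfty M"
  shows "(\<lambda>x. \<phi> x - \<psi> x) \<in> Linfty M"
proof -
  obtain C D where "AE x in M. \<bar>\<phi> x\<bar> \<le> C" "AE x in M. \<bar>\<psi> x\<bar> \<le> D"
    using assms by (auto simp: Linfty_iff_AE_bounded)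
  then have "AE x in M. \<bar>\<phi> x - \<psi> x\<bar> \<le> C + D" by eventually_elim linarith
  then show ?thesis using assms by (auto simp: Linfty_iff_AE_bounded)
qed

lemma indicator_in_Linfty: "A \<in> sets M \<Longrightarrow> indicator A \<in> Linfty M"
  by (auto simp: Linfty_iff_AE_bounded indicator_def intro!: exI[of _ 1])

lemma Linfty_norm_eq_0_AE:
  assumes "Linfty_norm M \<phi> = 0"
  shows "AE x in M. \<phi> x = 0"
  using esssup_AE[of "\<lambda>x. ereal \<bar>\<phi> x\<bar>" M] assms by (simp add: Linfty_norm_def)

section \<open>Measurable group actions\<close>

lemma group_actionI:
  assumes "group G"
    and ext: "\<And>g. g \<in> carrier G \<Longrightarrow> \<phi> g \<in> extensional E"
    and closed: "\<And>g x. g \<in> carrier G \<Longrightarrow> x \<in> E \<Longrightarrow> \<phi> g x \<in> E"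
    and one: "\<And>x. x \<in> E \<Longrightarrow> \<phi> \<one>\<^bsub>G\<^esub> x = x"
    and mult: "\<And>g h x. g \<in> carrier G \<Longrightarrow> h \<in> carrier G \<Longrightarrow> x \<in> E \<Longrightarrow>
      \<phi> (g \<otimes>\<^bsub>G\<^esub> h) x = \<phi> g (\<phi> h x)"
  shows "group_action G E \<phi>"
proof -
  interpret group G by fact
  have inv: "\<phi> (inv\<^bsub>G\<^esub> g) (\<phi> g x) = x" "\<phi> g (\<phi> (inv\<^bsub>G\<^esub> g) x) = x"
    if "g \<in> carrier G" "x \<in> E" for g x
    using that by (simp_all add: mult[symmetric] one)
  have bij: "\<phi> g \<in> Bij E" if "g \<in> carrier G" for g
    unfolding Bij_def
    by (intro IntI CollectI ext bij_betwI[where g = "\<phi> (inv\<^bsub>G\<^esub> g)"])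
       (use that closed inv in auto)
  have hom: "\<phi> (g \<otimes>\<^bsub>G\<^esub> h) = compose E (\<phi> g) (\<phi> h)" if "g \<in> carrier G" "h \<in> carrier G" for g h
    using that by (intro extensionalityI[of _ E]) (auto simp: ext mult compose_eq)
  have "\<phi> \<in> hom G (BijGroup E)"
    by (rule homI) (auto simp: BijGroup_def bij hom)
  then show ?thesis
    using \<open>group G\<close>
    by (intro group_action.intro group_hom.intro group_hom_axioms.intro group_BijGroup)
qed

lemma measurable_action_imp_group: "measurable_action G M \<alpha> \<Longrightarrow> group G"
  by (auto simp: measurable_action_def dest: group_action.group_hom group_hom.axioms(1))

lemma measurable_action_measurable:
  "measurable_action G M \<alpha> \<Longrightarrow> g \<in> carrier G \<Longrightarrow> \<alpha> g \<in> M \<rightarrow>\<^sub>M M"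
  by (simp add: measurable_action_def)

lemma measurable_action_closed:
  "measurable_action G M \<alpha> \<Longrightarrow> g \<in> carrier G \<Longrightarrow> x \<in> space M \<Longrightarrow> \<alpha> g x \<in> space M"
  by (blast intro: measurable_space measurable_action_measurable)

lemma measurable_action_one:
  "measurable_action G M \<alpha> \<Longrightarrow> x \<in> space M \<Longrightarrow> \<alpha> \<one>\<^bsub>G\<^esub> x = x"
  by (metis group_action.id_eq_one measurable_action_def restrict_apply')

lemma measurable_action_mult:
  assumes "measurable_action G M \<alpha>" "g \<in> carrier G" "h \<in> carrier G" "x \<in> space M"
  shows "\<alpha> (g \<otimes>\<^bsub>G\<^esub> h) x = \<alpha> g (\<alpha> h x)"
  using assms by (auto simp: measurable_action_def intro: group_action.composition_rule)

lemma
  assumes "measurable_action G M \<alpha>" "g \<in> carrier G" "x \<in> space M"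
  shows measurable_action_inv_left: "\<alpha> (inv\<^bsub>G\<^esub> g) (\<alpha> g x) = x"
    and measurable_action_inv_right: "\<alpha> g (\<alpha> (inv\<^bsub>G\<^esub> g) x) = x"
proof -
  interpret group G using assms(1) by (rule measurable_action_imp_group)
  show "\<alpha> (inv\<^bsub>G\<^esub> g) (\<alpha> g x) = x" "\<alpha> g (\<alpha> (inv\<^bsub>G\<^esub> g) x) = x"
    using assms by (simp_all add: measurable_action_mult[symmetric] measurable_action_one)
qed

lemma measurable_action_image_eq:
  assumes act: "measurable_action G M \<alpha>" and E: "E \<subseteq> space M"
    and closed: "\<And>g x. g \<in> carrier G \<Longrightarrow> x \<in> E \<Longrightarrow> \<alpha> g x \<in> E" and g: "g \<in> carrier G"
  shows "\<alpha> g ` E = E"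
proof
  interpret group G using act by (rule measurable_action_imp_group)
  show "\<alpha> g ` E \<subseteq> E" using closed[OF g] by auto
  show "E \<subseteq> \<alpha> g ` E"
  proof
    fix x assume "x \<in> E"
    then have "\<alpha> (inv\<^bsub>G\<^esub> g) x \<in> E" "x = \<alpha> g (\<alpha> (inv\<^bsub>G\<^esub> g) x)"
      using closed g E by (auto simp: measurable_action_inv_right[OF act])
    then show "x \<in> \<alpha> g ` E" by blast
  qed
qed

lemma measure_class_preserving_imp_measurable_action:
  "measure_class_preserving G M \<alpha> \<Longrightarrow> measurable_action G M \<alpha>"
  by (simp add: measure_class_preserving_def)

lemma measure_class_preserving_iff_vimage_null:
  "measure_class_preserving G M \<alpha> \<longleftrightarrow> measurable_action G M \<alpha> \<and>
     (\<forall>g\<in>carrier G. \<forall>N\<in>null_sets M. \<alpha> g -` N \<inter> space M \<in> null_sets M)"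
proof safe
  fix g N assume "measure_class_preserving G M \<alpha>" "g \<in> carrier G" "N \<in> null_sets M"
  then have "N \<in> null_sets (distr M M (\<alpha> g))" "\<alpha> g \<in> M \<rightarrow>\<^sub>M M"
    by (auto simp: measure_class_preserving_def intro: measurable_action_measurable)
  then show "\<alpha> g -` N \<inter> space M \<in> null_sets M" by (simp add: null_sets_distr_iff)
next
  assume act: "measurable_action G M \<alpha>"
    and null: "\<forall>g\<in>carrier G. \<forall>N\<in>null_sets M. \<alpha> g -` N \<inter> space M \<in> null_sets M"
  interpret group G using act by (rule measurable_action_imp_group)
  have "N \<in> null_sets M"
    if g: "g \<in> carrier G" and N: "N \<in> sets M" "\<alpha> g -` N \<inter> space M \<in> null_sets M" for g N
  proof -
    have "\<alpha> (inv\<^bsub>G\<^esub> g) -` (\<alpha> g -` N \<inter> space M) \<inter> space M = N"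
      using g sets.sets_into_space[OF N(1)]
      by (auto simp: measurable_action_inv_right[OF act] measurable_action_closed[OF act])
    then show ?thesis using null g N(2) by (metis inv_closed)
  qed
  then have "null_sets (distr M M (\<alpha> g)) = null_sets M" if "g \<in> carrier G" for g
    using that null measurable_action_measurable[OF act that]
    by (auto simp: null_sets_distr_iff)
  then show "measure_class_preserving G M \<alpha>" using act by (simp add: measure_class_preserving_def)
qed (rule measure_class_preserving_imp_measurable_action)

lemma measure_class_preserving_AE:
  assumes pres: "measure_class_preserving G M \<alpha>" and "g \<in> carrier G" "AE x in M. P x"
  shows "AE x in M. P (\<alpha> g x)"
proof -
  obtain N where N: "N \<in> null_sets M" "{x \<in> space M. \<not> P x} \<subseteq> N"
    using assms(3) by (auto simp: eventually_ae_filter)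
  have "\<alpha> g -` N \<inter> space M \<in> null_sets M"
    using assms N by (simp add: measure_class_preserving_iff_vimage_null)
  moreover have "{x \<in> space M. \<not> P (\<alpha> g x)} \<subseteq> \<alpha> g -` N \<inter> space M"
    using N(2) measurable_action_closed assms(2)
      measure_class_preserving_imp_measurable_action[OF pres] by fastforce
  ultimately show ?thesis by (rule AE_I')
qed

lemma ergodic_action_AE_dichotomy:
  assumes erg: "ergodic_action G M \<alpha>" and "countable (carrier G)"
    and P: "Measurable.pred M P"
    and inv: "AE x in M. \<forall>g\<in>carrier G. P (\<alpha> g x) \<longleftrightarrow> P x"
  shows "(AE x in M. P x) \<or> (AE x in M. \<not> P x)"
proof -
  have act: "measurable_action G M \<alpha>"
    using erg by (simp add: ergodic_action_def measure_class_preserving_def)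
  interpret group G using act by (rule measurable_action_imp_group)
  define E where "E = {x \<in> space M. \<forall>g\<in>carrier G. P (\<alpha> g x)}"
  have "E \<in> sets M"
    unfolding E_def using measurable_compose[OF measurable_action_measurable[OF act] P]
    by (intro sets.sets_Collect_countable_All' \<open>countable (carrier G)\<close>) (simp add: pred_def)
  have translate: "\<alpha> g x \<in> E" if "g \<in> carrier G" "x \<in> E" for g x
    using that by (auto simp: E_def measurable_action_closed[OF act]
        measurable_action_mult[OF act, symmetric])
  have "E \<subseteq> space M" by (auto simp: E_def)
  then have "\<alpha> g ` E = E" if "g \<in> carrier G" for g
    using measurable_action_image_eq[OF act _ translate that] by blast
  then have "E \<in> null_sets M \<or> space M - E \<in> null_sets M"
    using erg \<open>E \<in> sets M\<close> by (simp add: ergodic_action_def)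
  then show ?thesis
  proof
    assume "E \<in> null_sets M"
    then have "AE x in M. x \<notin> E" by (rule AE_not_in)
    then have "AE x in M. \<not> P x"
      using inv AE_space by eventually_elim (auto simp: E_def)
    then show ?thesis ..
  next
    assume "space M - E \<in> null_sets M"
    then have "AE x in M. x \<notin> space M - E" by (rule AE_not_in)
    then have "AE x in M. P x"
      using inv AE_space by eventually_elim (auto simp: E_def)
    then show ?thesis ..
  qed
qed

section \<open>Measured groups\<close>

lemma semigroup_generated_closed:
  assumes "group G" "S \<subseteq> carrier G" "g \<in> semigroup_generated G S"
  shows "g \<in> carrier G"
proof -
  interpret group G by fact
  show ?thesis using assms(3) by induction (use assms(2) in auto)
qed

lemma inv_semigroup_generated:
  assumes "group G" "S \<subseteq> carrier G" "g \<in> semigroup_generated G S"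
  shows "inv\<^bsub>G\<^esub> g \<in> semigroup_generated G (m_inv G ` S)"
  using assms(3)
proof induction
  case (incl s)
  then show ?case by (intro semigroup_generated.incl imageI)
next
  case (mult a b)
  then have "inv\<^bsub>G\<^esub> (a \<otimes>\<^bsub>G\<^esub> b) = inv\<^bsub>G\<^esub> b \<otimes>\<^bsub>G\<^esub> inv\<^bsub>G\<^esub> a"
    using assms(1,2) by (intro group.inv_mult_group semigroup_generated_closed)
  then show ?case using mult.IH by (simp add: semigroup_generated.mult)
qed

lemma measured_group_reflected_pmf:
  assumes "measured_group G \<mu>"
  shows "measured_group G (reflected_pmf G \<mu>)"
proof -
  interpret group G using assms by (simp add: measured_group_def)
  have support: "set_pmf \<mu> \<subseteq> carrier G" and gen: "semigroup_generated G (set_pmf \<mu>) = carrier G"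
    using assms by (auto simp: measured_group_def)
  have inv_support: "m_inv G ` set_pmf \<mu> \<subseteq> carrier G" using support by auto
  have "semigroup_generated G (m_inv G ` set_pmf \<mu>) = carrier G"
  proof
    show "semigroup_generated G (m_inv G ` set_pmf \<mu>) \<subseteq> carrier G"
      using semigroup_generated_closed[OF is_group inv_support] by blast
    show "carrier G \<subseteq> semigroup_generated G (m_inv G ` set_pmf \<mu>)"
      using inv_semigroup_generated[OF is_group support]
      unfolding gen by (metis inv_closed inv_inv subsetI)
  qed
  then show ?thesis
    using assms inv_support by (simp add: measured_group_def reflected_pmf_def)
qed

lemma reflected_pmf_reflected_pmf:
  assumes "measured_group G \<mu>"
  shows "reflected_pmf G (reflected_pmf G \<mu>) = \<mu>"
proof -
  interpret group G using assms by (simp add: measured_group_def)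
  have "map_pmf (\<lambda>g. inv\<^bsub>G\<^esub> (inv\<^bsub>G\<^esub> g)) \<mu> = map_pmf (\<lambda>g. g) \<mu>"
    by (rule map_pmf_cong) (use assms in \<open>auto simp: measured_group_def\<close>)
  then show ?thesis by (simp add: reflected_pmf_def map_pmf_comp map_pmf_ident)
qed

section \<open>Stationary actions\<close>

text \<open>The average is over \<open>g\<close>, where that of a \<open>(G, \<mu>)\<close>-space is over \<open>g\<inverse>\<close>: a \<open>(G, \<mu>)\<close>-space is
  stationary for the reflected measure.\<close>

definition stationary :: "'g pmf \<Rightarrow> 'x measure \<Rightarrow> ('g \<Rightarrow> 'x \<Rightarrow> 'x) \<Rightarrow> bool" where
  "stationary \<mu> M \<alpha> \<longleftrightarrow>
     (\<forall>f\<in>borel_measurable M. (\<integral>\<^sup>+g. \<integral>\<^sup>+x. f (\<alpha> g x) \<partial>M \<partial>measure_pmf \<mu>) = (\<integral>\<^sup>+x. f x \<partial>M))"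

lemma stationaryD:
  "stationary \<mu> M \<alpha> \<Longrightarrow> f \<in> borel_measurable M \<Longrightarrow>
    (\<integral>\<^sup>+g. \<integral>\<^sup>+x. f (\<alpha> g x) \<partial>M \<partial>measure_pmf \<mu>) = (\<integral>\<^sup>+x. f x \<partial>M)"
  by (simp add: stationary_def)

lemma stationaryI_emeasure:
  assumes meas: "\<And>g. g \<in> set_pmf \<mu> \<Longrightarrow> \<alpha> g \<in> M \<rightarrow>\<^sub>M M"
    and emeasure: "\<And>A. A \<in> sets M \<Longrightarrow>
      (\<integral>\<^sup>+g. emeasure M (\<alpha> g -` A \<inter> space M) \<partial>measure_pmf \<mu>) = emeasure M A"
  shows "stationary \<mu> M \<alpha>"
  unfolding stationary_def
proof
  fix f :: "_ \<Rightarrow> ennreal" assume f: "f \<in> borel_measurable M"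
  have "(\<integral>\<^sup>+g. \<integral>\<^sup>+x. f (\<alpha> g x) \<partial>M \<partial>measure_pmf \<mu>) =
      (\<integral>\<^sup>+g. \<integral>\<^sup>+x. f x \<partial>distr M M (\<alpha> g) \<partial>measure_pmf \<mu>)"
    by (intro nn_integral_measure_pmf_cong) (simp add: nn_integral_distr meas f)
  also have "\<dots> = (\<integral>\<^sup>+x. f x \<partial>M)"
    using f by (intro nn_integral_mixture_measure_pmf)
      (simp_all add: emeasure_distr meas emeasure cong: nn_integral_measure_pmf_cong)
  finally show "(\<integral>\<^sup>+g. \<integral>\<^sup>+x. f (\<alpha> g x) \<partial>M \<partial>measure_pmf \<mu>) = (\<integral>\<^sup>+x. f x \<partial>M)" .
qed

lemma measure_preserving_action_imp_stationary:
  assumes "measure_preserving_action G M \<alpha>" "set_pmf \<mu> \<subseteq> carrier G"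
  shows "stationary \<mu> M \<alpha>"
  unfolding stationary_def
proof
  fix f :: "_ \<Rightarrow> ennreal" assume f: "f \<in> borel_measurable M"
  have "(\<integral>\<^sup>+x. f (\<alpha> g x) \<partial>M) = (\<integral>\<^sup>+x. f x \<partial>M)" if "g \<in> set_pmf \<mu>" for g
  proof -
    have "\<alpha> g \<in> M \<rightarrow>\<^sub>M M" "distr M M (\<alpha> g) = M"
      using assms that by (auto simp: measure_preserving_action_def measurable_action_def)
    then show ?thesis using nn_integral_distr[of "\<alpha> g" M M f] f by simp
  qed
  then show "(\<integral>\<^sup>+g. \<integral>\<^sup>+x. f (\<alpha> g x) \<partial>M \<partial>measure_pmf \<mu>) = (\<integral>\<^sup>+x. f x \<partial>M)"
    by (simp cong: nn_integral_measure_pmf_cong)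
qed

lemma measured_group_space_imp_stationary:
  assumes "measured_group G \<mu>" and space: "measured_group_space G \<mu> M \<alpha>"
  shows "stationary (reflected_pmf G \<mu>) M \<alpha>"
proof (rule stationaryI_emeasure)
  have act: "measurable_action G M \<alpha>"
    using space by (simp add: measured_group_space_def measure_class_preserving_def)
  interpret group G using act by (rule measurable_action_imp_group)
  interpret prob_space M using space by (simp add: measured_group_space_def)
  have support: "set_pmf \<mu> \<subseteq> carrier G" using assms(1) by (simp add: measured_group_def)
  show "\<alpha> g \<in> M \<rightarrow>\<^sub>M M" if "g \<in> set_pmf (reflected_pmf G \<mu>)" for g
    using support that by (auto simp: reflected_pmf_def intro: measurable_action_measurable[OF act])
  fix A assume A: "A \<in> sets M"
  let ?B = "\<lambda>g. \<alpha> (inv\<^bsub>G\<^esub> g) -` A \<inter> space M"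
  have "(\<integral>x. indicator A (\<alpha> (inv\<^bsub>G\<^esub> g) x) \<partial>M) = measure M (?B g)" for g
  proof -
    have "(\<integral>x. indicator A (\<alpha> (inv\<^bsub>G\<^esub> g) x) \<partial>M) = (\<integral>x. indicator (?B g) x \<partial>M)"
      by (rule Bochner_Integration.integral_cong) (auto simp: indicator_def)
    also have "\<dots> = measure M (?B g)" by simp
    finally show ?thesis .
  qed
  moreover have "(\<integral>g. \<integral>x. indicator A (\<alpha> (inv\<^bsub>G\<^esub> g) x) \<partial>M \<partial>measure_pmf \<mu>) =
      (\<integral>x. indicator A x \<partial>M :: real)"
    using space indicator_in_Linfty[OF A] unfolding measured_group_space_def by blast
  ultimately have "(\<integral>g. measure M (?B g) \<partial>measure_pmf \<mu>) = measure M A"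
    using A by simp
  then have "ennreal (\<integral>g. measure M (?B g) \<partial>measure_pmf \<mu>) = emeasure M A"
    by (simp add: emeasure_eq_measure)
  moreover have "(\<integral>\<^sup>+g. emeasure M (?B g) \<partial>measure_pmf \<mu>) =
      ennreal (\<integral>g. measure M (?B g) \<partial>measure_pmf \<mu>)"
    unfolding emeasure_eq_measure
    by (intro nn_integral_eq_integral measure_pmf.integrable_const_bound[of _ 1]) auto
  ultimately show "(\<integral>\<^sup>+g. emeasure M (\<alpha> g -` A \<inter> space M) \<partial>measure_pmf (reflected_pmf G \<mu>)) =
      emeasure M A"
    by (simp add: reflected_pmf_def)
qed

lemma harmonic_correlation:
  fixes \<Phi> :: "'x \<Rightarrow> real"
  assumes meas: "\<And>g. g \<in> set_pmf \<mu> \<Longrightarrow> \<alpha> g \<in> M \<rightarrow>\<^sub>M M"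
    and \<Phi>: "\<Phi> \<in> borel_measurable M" and nonneg: "\<And>x. 0 \<le> \<Phi> x"
    and harmonic: "\<And>x. x \<in> space M \<Longrightarrow> (\<integral>\<^sup>+g. \<Phi> (\<alpha> g x) \<partial>measure_pmf \<mu>) = \<Phi> x"
  shows "(\<integral>\<^sup>+g. \<integral>\<^sup>+x. \<Phi> (\<alpha> g x) * \<Phi> x \<partial>M \<partial>measure_pmf \<mu>) = (\<integral>\<^sup>+x. (\<Phi> x)\<^sup>2 \<partial>M)"
proof -
  note [measurable] = \<Phi> measurable_compose[OF meas \<Phi>]
  have "(\<integral>\<^sup>+g. \<integral>\<^sup>+x. \<Phi> (\<alpha> g x) * \<Phi> x \<partial>M \<partial>measure_pmf \<mu>) =
      (\<integral>\<^sup>+x. \<integral>\<^sup>+g. \<Phi> (\<alpha> g x) * \<Phi> x \<partial>measure_pmf \<mu> \<partial>M)"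
    by (rule nn_integral_measure_pmf_swap) measurable
  also have "\<dots> = (\<integral>\<^sup>+x. \<Phi> x * \<Phi> x \<partial>M)"
    by (intro nn_integral_cong) (simp add: nonneg ennreal_mult nn_integral_multc harmonic)
  finally show ?thesis by (simp add: power2_eq_square)
qed

lemma stationary_harmonic_energy_eq_0:
  fixes \<Phi> :: "'x \<Rightarrow> real"
  assumes stat: "stationary \<mu> M \<alpha>" and meas: "\<And>g. g \<in> set_pmf \<mu> \<Longrightarrow> \<alpha> g \<in> M \<rightarrow>\<^sub>M M"
    and \<Phi>: "\<Phi> \<in> borel_measurable M" and nonneg: "\<And>x. 0 \<le> \<Phi> x"
    and square_integrable: "(\<integral>\<^sup>+x. (\<Phi> x)\<^sup>2 \<partial>M) < \<infinity>"
    and harmonic: "\<And>x. x \<in> space M \<Longrightarrow> (\<integral>\<^sup>+g. \<Phi> (\<alpha> g x) \<partial>measure_pmf \<mu>) = \<Phi> x"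
  shows "(\<integral>\<^sup>+g. \<integral>\<^sup>+x. (\<Phi> (\<alpha> g x) - \<Phi> x)\<^sup>2 \<partial>M \<partial>measure_pmf \<mu>) = 0" (is "?energy = 0")
proof -
  let ?correlation = "\<lambda>g. \<integral>\<^sup>+x. \<Phi> (\<alpha> g x) * \<Phi> x \<partial>M"
  define second_moment where "second_moment = (\<integral>\<^sup>+x. (\<Phi> x)\<^sup>2 \<partial>M)"
  have "?energy + 2 * second_moment = ?energy + 2 * (\<integral>\<^sup>+g. ?correlation g \<partial>measure_pmf \<mu>)"
    unfolding second_moment_def using harmonic_correlation[OF meas \<Phi> nonneg harmonic] by simp
  also have "\<dots> = (\<integral>\<^sup>+g. (\<integral>\<^sup>+x. (\<Phi> (\<alpha> g x) - \<Phi> x)\<^sup>2 \<partial>M) + 2 * ?correlation g \<partial>measure_pmf \<mu>)"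
    by (simp add: nn_integral_add nn_integral_cmult)
  also have "\<dots> = (\<integral>\<^sup>+g. (\<integral>\<^sup>+x. (\<Phi> (\<alpha> g x))\<^sup>2 \<partial>M) + second_moment \<partial>measure_pmf \<mu>)"
    unfolding second_moment_def
    by (intro nn_integral_measure_pmf_cong nn_integral_power2_diff
        measurable_compose[OF meas \<Phi>] \<Phi> nonneg)
  also have "\<dots> = (\<integral>\<^sup>+g. \<integral>\<^sup>+x. (\<Phi> (\<alpha> g x))\<^sup>2 \<partial>M \<partial>measure_pmf \<mu>) + second_moment"
    by (simp add: nn_integral_add)
  also have "(\<integral>\<^sup>+g. \<integral>\<^sup>+x. (\<Phi> (\<alpha> g x))\<^sup>2 \<partial>M \<partial>measure_pmf \<mu>) = second_moment"
    unfolding second_moment_def by (rule stationaryD[OF stat]) (use \<Phi> in measurable)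
  finally have "?energy + 2 * second_moment = 2 * second_moment"
    by (simp add: mult_2)
  then show ?thesis
    using square_integrable unfolding second_moment_def[symmetric]
    by (auto simp: mult_2)
qed

lemma stationary_harmonic_AE_invariant:
  fixes \<Phi> :: "'x \<Rightarrow> real"
  assumes "stationary \<mu> M \<alpha>" and meas: "\<And>g. g \<in> set_pmf \<mu> \<Longrightarrow> \<alpha> g \<in> M \<rightarrow>\<^sub>M M"
    and \<Phi>: "\<Phi> \<in> borel_measurable M" and "\<And>x. 0 \<le> \<Phi> x" "(\<integral>\<^sup>+x. (\<Phi> x)\<^sup>2 \<partial>M) < \<infinity>"
    and "\<And>x. x \<in> space M \<Longrightarrow> (\<integral>\<^sup>+g. \<Phi> (\<alpha> g x) \<partial>measure_pmf \<mu>) = \<Phi> x"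
    and g: "g \<in> set_pmf \<mu>"
  shows "AE x in M. \<Phi> (\<alpha> g x) = \<Phi> x"
proof -
  have "AE h in measure_pmf \<mu>. (\<integral>\<^sup>+x. (\<Phi> (\<alpha> h x) - \<Phi> x)\<^sup>2 \<partial>M) = 0"
    using stationary_harmonic_energy_eq_0[OF assms(1-6)] by (simp add: nn_integral_0_iff_AE)
  then have "(\<integral>\<^sup>+x. (\<Phi> (\<alpha> g x) - \<Phi> x)\<^sup>2 \<partial>M) = 0"
    using g by (simp add: AE_measure_pmf_iff)
  moreover have "(\<lambda>x. \<Phi> (\<alpha> g x)) \<in> borel_measurable M"
    using measurable_compose[OF meas[OF g] \<Phi>] .
  ultimately show ?thesis using \<Phi> by (simp add: nn_integral_0_iff_AE)
qed

lemma AE_invariant_semigroup_generated: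
  assumes pres: "measure_class_preserving G M \<alpha>" and "S \<subseteq> carrier G"
    and generators: "\<And>s. s \<in> S \<Longrightarrow> AE x in M. \<Phi> (\<alpha> s x) = \<Phi> x"
    and "g \<in> semigroup_generated G S"
  shows "AE x in M. \<Phi> (\<alpha> g x) = \<Phi> x"
  using assms(4)
proof induction
  case (incl s)
  then show ?case by (rule generators)
next
  case (mult a b)
  have act: "measurable_action G M \<alpha>"
    using pres by (rule measure_class_preserving_imp_measurable_action)
  have ab: "a \<in> carrier G" "b \<in> carrier G"
    using mult.hyps assms(2)
    by (auto intro: semigroup_generated_closed measurable_action_imp_group[OF act])
  have "AE x in M. \<Phi> (\<alpha> a (\<alpha> b x)) = \<Phi> (\<alpha> b x)"
    using pres ab(2) mult.IH(1) by (rule measure_class_preserving_AE)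
  then show ?case
    using mult.IH(2) AE_space
    by eventually_elim (simp add: ab measurable_action_mult[OF act])
qed

section \<open>Diagonal actions on products\<close>

definition prod_action ::
    "'x measure \<Rightarrow> ('g \<Rightarrow> 'x \<Rightarrow> 'x) \<Rightarrow> 'y measure \<Rightarrow> ('g \<Rightarrow> 'y \<Rightarrow> 'y) \<Rightarrow> 'g \<Rightarrow> 'x \<times> 'y \<Rightarrow> 'x \<times> 'y" where
  "prod_action M \<alpha> N \<beta> g = (\<lambda>(x, y)\<in>space M \<times> space N. (\<alpha> g x, \<beta> g y))"

lemma prod_action_apply [simp]:
  "x \<in> space M \<Longrightarrow> y \<in> space N \<Longrightarrow> prod_action M \<alpha> N \<beta> g (x, y) = (\<alpha> g x, \<beta> g y)"
  by (simp add: prod_action_def)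

lemma diagonal_action_eq_prod_action:
  "diagonal_action L \<alpha> M \<beta> N \<gamma> = prod_action L \<alpha> (M \<Otimes>\<^sub>M N) (prod_action M \<beta> N \<gamma>)"
  by (auto simp: fun_eq_iff diagonal_action_def prod_action_def space_pair_measure restrict_def)

lemma measurable_action_prod_action:
  assumes actM: "measurable_action G M \<alpha>" and actN: "measurable_action G N \<beta>"
  shows "measurable_action G (M \<Otimes>\<^sub>M N) (prod_action M \<alpha> N \<beta>)"
  unfolding measurable_action_def
proof (intro conjI ballI)
  show "group_action G (space (M \<Otimes>\<^sub>M N)) (prod_action M \<alpha> N \<beta>)"
  proof (rule group_actionI)
    show "group G" using actM by (rule measurable_action_imp_group)
    show "prod_action M \<alpha> N \<beta> g \<in> extensional (space (M \<Otimes>\<^sub>M N))" for g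
      by (simp add: prod_action_def space_pair_measure)
  qed (auto simp: space_pair_measure
      measurable_action_closed[OF actM] measurable_action_closed[OF actN]
      measurable_action_one[OF actM] measurable_action_one[OF actN]
      measurable_action_mult[OF actM] measurable_action_mult[OF actN])
  fix g assume g: "g \<in> carrier G"
  note [measurable] =
    measurable_action_measurable[OF actM g] measurable_action_measurable[OF actN g]
  have "(\<lambda>z. (\<alpha> g (fst z), \<beta> g (snd z))) \<in> M \<Otimes>\<^sub>M N \<rightarrow>\<^sub>M M \<Otimes>\<^sub>M N" by measurable
  then show "prod_action M \<alpha> N \<beta> g \<in> M \<Otimes>\<^sub>M N \<rightarrow>\<^sub>M M \<Otimes>\<^sub>M N"
    by (rule measurable_cong[THEN iffD1, rotated]) (auto simp: space_pair_measure)
qed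

lemma section_vimage_prod_action:
  assumes "y \<in> space N" "\<beta> g y \<in> space N"
  shows "(\<lambda>x. (x, y)) -` (prod_action M \<alpha> N \<beta> g -` S \<inter> space (M \<Otimes>\<^sub>M N)) =
    \<alpha> g -` ((\<lambda>x. (x, \<beta> g y)) -` S) \<inter> space M"
  using assms by (auto simp: space_pair_measure)

lemma measure_class_preserving_prod_action:
  assumes "sigma_finite_measure M" "sigma_finite_measure N"
    and presM: "measure_class_preserving G M \<alpha>" and presN: "measure_class_preserving G N \<beta>"
  shows "measure_class_preserving G (M \<Otimes>\<^sub>M N) (prod_action M \<alpha> N \<beta>)"
  unfolding measure_class_preserving_iff_vimage_null
proof (intro conjI ballI)
  interpret pair_sigma_finite M N using assms(1,2) by (rule pair_sigma_finite.intro)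
  have actM: "measurable_action G M \<alpha>" and actN: "measurable_action G N \<beta>"
    using presM presN by (auto intro: measure_class_preserving_imp_measurable_action)
  show act: "measurable_action G (M \<Otimes>\<^sub>M N) (prod_action M \<alpha> N \<beta>)"
    using actM actN by (rule measurable_action_prod_action)
  fix g S assume g: "g \<in> carrier G" and S: "S \<in> null_sets (M \<Otimes>\<^sub>M N)"
  let ?T = "prod_action M \<alpha> N \<beta> g -` S \<inter> space (M \<Otimes>\<^sub>M N)"
  have T: "?T \<in> sets (M \<Otimes>\<^sub>M N)"
    using measurable_action_measurable[OF act g] S by (intro measurable_sets) auto
  have "AE y in N. (\<lambda>x. (x, y)) -` S \<in> null_sets M"
    using S null_sets_pair_measure_iff2[of S] by (simp add: null_setsD2)
  then have "AE y in N. (\<lambda>x. (x, \<beta> g y)) -` S \<in> null_sets M"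
    by (rule measure_class_preserving_AE[OF presN g])
  then have "AE y in N. (\<lambda>x. (x, y)) -` ?T \<in> null_sets M"
    using AE_space
  proof eventually_elim
    case (elim y)
    have "\<alpha> g -` ((\<lambda>x. (x, \<beta> g y)) -` S) \<inter> space M \<in> null_sets M"
      using presM g elim(1) by (simp add: measure_class_preserving_iff_vimage_null)
    then show ?case
      using elim(2) measurable_action_closed[OF actN g] by (simp only: section_vimage_prod_action)
  qed
  then show "?T \<in> null_sets (M \<Otimes>\<^sub>M N)" using null_sets_pair_measure_iff2[OF T] by blast
qed

lemma stationary_prod_action:
  assumes "sigma_finite_measure M" "sigma_finite_measure N" and support: "set_pmf \<mu> \<subseteq> carrier G"
    and actM: "measurable_action G M \<alpha>" and stat: "stationary \<mu> M \<alpha>"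
    and presN: "measure_preserving_action G N \<beta>"
  shows "stationary \<mu> (M \<Otimes>\<^sub>M N) (prod_action M \<alpha> N \<beta>)"
  unfolding stationary_def
proof
  interpret pair_sigma_finite M N using assms(1,2) by (rule pair_sigma_finite.intro)
  fix f :: "_ \<Rightarrow> ennreal" assume f [measurable]: "f \<in> borel_measurable (M \<Otimes>\<^sub>M N)"
  have translate: "(\<integral>\<^sup>+z. f (prod_action M \<alpha> N \<beta> g z) \<partial>(M \<Otimes>\<^sub>M N)) =
      (\<integral>\<^sup>+y. \<integral>\<^sup>+x. f (\<alpha> g x, y) \<partial>M \<partial>N)" if "g \<in> set_pmf \<mu>" for g
  proof -
    have [measurable]: "\<alpha> g \<in> M \<rightarrow>\<^sub>M M" "\<beta> g \<in> N \<rightarrow>\<^sub>M N" and dist: "distr N N (\<beta> g) = N"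
      using actM presN that support
      by (auto simp: measure_preserving_action_def measurable_action_def)
    have "(\<integral>\<^sup>+z. f (prod_action M \<alpha> N \<beta> g z) \<partial>(M \<Otimes>\<^sub>M N)) =
        (\<integral>\<^sup>+z. f (\<alpha> g (fst z), \<beta> g (snd z)) \<partial>(M \<Otimes>\<^sub>M N))"
      by (rule nn_integral_cong) (auto simp: space_pair_measure)
    also have "\<dots> = (\<integral>\<^sup>+y. \<integral>\<^sup>+x. f (\<alpha> g x, \<beta> g y) \<partial>M \<partial>N)"
      by (subst nn_integral_snd[symmetric]) simp_all
    also have "\<dots> = (\<integral>\<^sup>+y. \<integral>\<^sup>+x. f (\<alpha> g x, y) \<partial>M \<partial>distr N N (\<beta> g))"
      by (subst nn_integral_distr) simp_all
    finally show ?thesis by (simp add: dist)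
  qed
  have "(\<integral>\<^sup>+g. \<integral>\<^sup>+z. f (prod_action M \<alpha> N \<beta> g z) \<partial>(M \<Otimes>\<^sub>M N) \<partial>measure_pmf \<mu>) =
      (\<integral>\<^sup>+g. \<integral>\<^sup>+y. \<integral>\<^sup>+x. f (\<alpha> g x, y) \<partial>M \<partial>N \<partial>measure_pmf \<mu>)"
    by (intro nn_integral_measure_pmf_cong translate)
  also have "\<dots> = (\<integral>\<^sup>+y. \<integral>\<^sup>+g. \<integral>\<^sup>+x. f (\<alpha> g x, y) \<partial>M \<partial>measure_pmf \<mu> \<partial>N)"
  proof (rule nn_integral_measure_pmf_swap)
    fix g assume "g \<in> set_pmf \<mu>"
    then have [measurable]: "\<alpha> g \<in> M \<rightarrow>\<^sub>M M"
      using actM support by (auto intro: measurable_action_measurable)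
    show "(\<lambda>y. \<integral>\<^sup>+x. f (\<alpha> g x, y) \<partial>M) \<in> borel_measurable N" by measurable
  qed
  also have "\<dots> = (\<integral>\<^sup>+y. \<integral>\<^sup>+x. f (x, y) \<partial>M \<partial>N)"
    by (intro nn_integral_cong stationaryD[OF stat]) measurable
  also have "\<dots> = (\<integral>\<^sup>+z. f z \<partial>(M \<Otimes>\<^sub>M N))" by (rule nn_integral_snd[OF f])
  finally show "(\<integral>\<^sup>+g. \<integral>\<^sup>+z. f (prod_action M \<alpha> N \<beta> g z) \<partial>(M \<Otimes>\<^sub>M N) \<partial>measure_pmf \<mu>) =
      (\<integral>\<^sup>+z. f z \<partial>(M \<Otimes>\<^sub>M N))" .
qed

section \<open>Poisson boundaries\<close>

lemma poisson_transform_linear: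
  assumes "poisson_boundary G \<mu> M \<alpha>" "\<phi> \<in> Linfty M" "\<psi> \<in> Linfty M" "g \<in> carrier G"
  shows "poisson_transform G M \<alpha> (\<lambda>x. a * \<phi> x + b * \<psi> x) g =
    a * poisson_transform G M \<alpha> \<phi> g + b * poisson_transform G M \<alpha> \<psi> g"
  using assms by (simp add: poisson_boundary_def)

lemma poisson_boundary_constant:
  assumes boundary: "poisson_boundary G \<mu> M \<alpha>" and \<phi>: "\<phi> \<in> Linfty M"
    and const: "\<And>g. g \<in> carrier G \<Longrightarrow> poisson_transform G M \<alpha> \<phi> g = c"
  shows "AE x in M. \<phi> x = c"
proof -
  have "measurable_action G M \<alpha>" and prob: "prob_space M"
    using boundary
    by (auto simp: poisson_boundary_def ergodic_action_def measure_class_preserving_def)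
  then interpret group G by (intro measurable_action_imp_group)
  interpret prob_space M by (rule prob)
  have "poisson_transform G M \<alpha> (\<lambda>x. \<phi> x - c) g = 0" if g: "g \<in> carrier G" for g
  proof -
    have "poisson_transform G M \<alpha> (\<lambda>x. 1 * \<phi> x + (- c) * 1) g =
        1 * poisson_transform G M \<alpha> \<phi> g + (- c) * poisson_transform G M \<alpha> (\<lambda>x. 1) g"
      using boundary \<phi> Linfty_const g by (rule poisson_transform_linear)
    moreover have "poisson_transform G M \<alpha> (\<lambda>x. 1) g = 1"
      using g by (simp add: poisson_transform_def prob_space)
    ultimately show ?thesis by (simp add: const[OF g])
  qed
  then have "sup_norm G (poisson_transform G M \<alpha> (\<lambda>x. \<phi> x - c)) = 0"
    using carrier_not_empty by (simp add: sup_norm_def)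
  then have "Linfty_norm M (\<lambda>x. \<phi> x - c) = 0"
    using boundary Linfty_diff[OF \<phi> Linfty_const] by (simp add: poisson_boundary_def)
  from Linfty_norm_eq_0_AE[OF this] show ?thesis by simp
qed

lemma poisson_boundary_indicator_constant:
  assumes boundary: "poisson_boundary G \<mu> M \<alpha>" and A: "A \<in> sets M"
    and const: "\<And>g. g \<in> carrier G \<Longrightarrow> poisson_transform G M \<alpha> (indicator A) g = c"
  shows "c = 0 \<or> c = 1"
proof -
  interpret prob_space M using boundary by (simp add: poisson_boundary_def ergodic_action_def)
  have "AE x in M. indicator A x = c"
    using boundary indicator_in_Linfty[OF A] const by (rule poisson_boundary_constant)
  then have "AE x in M. c = 0 \<or> c = 1"
    by eventually_elim (auto simp: indicator_def split: if_splits)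
  then show ?thesis by simp
qed

section \<open>Sections of invariant sets\<close>

definition section_measure :: "'x measure \<Rightarrow> ('x \<times> 'y) set \<Rightarrow> 'y \<Rightarrow> real" where
  "section_measure M S y = measure M ((\<lambda>x. (x, y)) -` S)"

lemma (in pair_sigma_finite) borel_measurable_section_measure:
  "S \<in> sets (M1 \<Otimes>\<^sub>M M2) \<Longrightarrow> section_measure M1 S \<in> borel_measurable M2"
  unfolding section_measure_def measure_def
  by (intro borel_measurable_enn2real measurable_emeasure_Pair2)

lemma (in pair_prob_space) null_sets_iff_section_measure:
  assumes "S \<in> sets (M1 \<Otimes>\<^sub>M M2)"
  shows "S \<in> null_sets (M1 \<Otimes>\<^sub>M M2) \<longleftrightarrow> (AE y in M2. section_measure M1 S y = 0)"
proof -
  have "(\<lambda>x. (x, y)) -` S \<in> null_sets M1 \<longleftrightarrow> section_measure M1 S y = 0" for y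
    by (simp add: section_measure_def null_sets_def sets_Pair2[OF assms] M1.emeasure_eq_measure)
  then show ?thesis by (simp only: null_sets_pair_measure_iff2[OF assms])
qed

lemma (in pair_prob_space) section_measure_compl:
  assumes S: "S \<in> sets (M1 \<Otimes>\<^sub>M M2)" and "y \<in> space M2"
  shows "section_measure M1 (space (M1 \<Otimes>\<^sub>M M2) - S) y = 1 - section_measure M1 S y"
proof -
  have "(\<lambda>x. (x, y)) -` (space (M1 \<Otimes>\<^sub>M M2) - S) = space M1 - (\<lambda>x. (x, y)) -` S"
    using assms(2) by (auto simp: space_pair_measure)
  then show ?thesis by (simp add: section_measure_def M1.prob_compl sets_Pair2[OF S])
qed

context
  fixes G :: "('g, 'z) monoid_scheme" and M :: "'x measure" and \<alpha> :: "'g \<Rightarrow> 'x \<Rightarrow> 'x"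
    and N :: "'y measure" and \<beta> :: "'g \<Rightarrow> 'y \<Rightarrow> 'y" and S :: "('x \<times> 'y) set"
  assumes actM: "measurable_action G M \<alpha>" and actN: "measurable_action G N \<beta>"
    and S: "S \<in> sets (M \<Otimes>\<^sub>M N)"
    and invariant: "\<And>g. g \<in> carrier G \<Longrightarrow> prod_action M \<alpha> N \<beta> g ` S = S"
begin

lemma section_translate:
  assumes g: "g \<in> carrier G" and y: "y \<in> space N"
  shows "(\<lambda>x. (x, \<beta> g y)) -` S = \<alpha> (inv\<^bsub>G\<^esub> g) -` ((\<lambda>x. (x, y)) -` S) \<inter> space M"
proof -
  interpret group G using actM by (rule measurable_action_imp_group)
  have space: "x \<in> space M" "z \<in> space N" if "(x, z) \<in> S" for x z
    using that sets.sets_into_space[OF S] by (auto simp: space_pair_measure)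
  have translate: "(\<alpha> h x, \<beta> h z) \<in> S" if "(x, z) \<in> S" "h \<in> carrier G" for x z h
    using imageI[OF that(1), of "prod_action M \<alpha> N \<beta> h"] invariant[OF that(2)] space[OF that(1)]
    by simp
  have "(x, \<beta> g y) \<in> S \<longleftrightarrow> (\<alpha> (inv\<^bsub>G\<^esub> g) x, y) \<in> S" if "x \<in> space M" for x
    using translate[of x "\<beta> g y" "inv\<^bsub>G\<^esub> g"] translate[of "\<alpha> (inv\<^bsub>G\<^esub> g) x" y g] g y that
    by (auto simp: measurable_action_inv_left[OF actN] measurable_action_inv_right[OF actM])
  then show ?thesis using space(1) by blast
qed

lemma poisson_transform_indicator_section:
  assumes "g \<in> carrier G" "y \<in> space N"
  shows "poisson_transform G M \<alpha> (indicator ((\<lambda>x. (x, y)) -` S)) g = section_measure M S (\<beta> g y)"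
proof -
  have "poisson_transform G M \<alpha> (indicator ((\<lambda>x. (x, y)) -` S)) g =
      (\<integral>x. indicator ((\<lambda>x. (x, \<beta> g y)) -` S) x \<partial>M)"
    unfolding poisson_transform_def section_translate[OF assms]
    using assms(1) by (auto intro!: Bochner_Integration.integral_cong simp: indicator_def)
  also have "\<dots> = measure M ((\<lambda>x. (x, \<beta> g y)) -` S \<inter> space M)" by simp
  finally show ?thesis
    by (simp add: section_measure_def Int_absorb2 sets.sets_into_space sets_Pair2[OF S])
qed

lemma section_measure_harmonic:
  assumes "measured_group G \<mu>" "measured_group_space G \<mu> M \<alpha>" and y: "y \<in> space N"
  shows "(\<integral>\<^sup>+g. section_measure M S (\<beta> g y) \<partial>measure_pmf \<mu>) = section_measure M S y"
proof -
  interpret prob_space M using assms(2) by (simp add: measured_group_space_def)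
  let ?A = "(\<lambda>x. (x, y)) -` S"
  have A: "?A \<in> sets M" by (rule sets_Pair2[OF S])
  have "ennreal (section_measure M S (\<beta> g y)) = (\<integral>\<^sup>+x. indicator ?A (\<alpha> (inv\<^bsub>G\<^esub> g) x) \<partial>M)"
    if "g \<in> set_pmf \<mu>" for g
  proof -
    have g: "g \<in> carrier G" using that assms(1) by (auto simp: measured_group_def)
    have "ennreal (section_measure M S (\<beta> g y)) = (\<integral>\<^sup>+x. indicator ((\<lambda>x. (x, \<beta> g y)) -` S) x \<partial>M)"
      using sets_Pair2[OF S] by (simp add: section_measure_def emeasure_eq_measure)
    then show ?thesis
      unfolding section_translate[OF g y] by (simp add: indicator_def cong: nn_integral_cong)
  qed
  then have "(\<integral>\<^sup>+g. section_measure M S (\<beta> g y) \<partial>measure_pmf \<mu>) =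
      (\<integral>\<^sup>+g. \<integral>\<^sup>+x. indicator ?A (\<alpha> g x) \<partial>M \<partial>measure_pmf (reflected_pmf G \<mu>))"
    unfolding reflected_pmf_def nn_integral_map_pmf by (rule nn_integral_measure_pmf_cong)
  also have "\<dots> = (\<integral>\<^sup>+x. indicator ?A x \<partial>M)"
    by (rule stationaryD[OF measured_group_space_imp_stationary[OF assms(1,2)]])
      (use A in measurable)
  finally show ?thesis using A by (simp add: section_measure_def emeasure_eq_measure)
qed

lemma section_measure_AE_invariant:
  assumes \<mu>: "measured_group G \<mu>" and space: "measured_group_space G \<mu> M \<alpha>"
    and "prob_space N" and pres: "measure_class_preserving G N \<beta>" and stat: "stationary \<mu> N \<beta>"
  shows "AE y in N. \<forall>g\<in>carrier G. section_measure M S (\<beta> g y) = section_measure M S y"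
proof -
  interpret M: prob_space M using space by (simp add: measured_group_space_def)
  interpret N: prob_space N by fact
  interpret pair_prob_space M N ..
  have "(\<integral>\<^sup>+y. (section_measure M S y)\<^sup>2 \<partial>N) \<le> (\<integral>\<^sup>+y. 1 \<partial>N)"
    by (intro nn_integral_mono) (simp add: section_measure_def power_le_one)
  then have square_integrable: "(\<integral>\<^sup>+y. (section_measure M S y)\<^sup>2 \<partial>N) < \<infinity>"
    using order_le_less_trans by (fastforce simp: N.emeasure_space_1)
  have support: "AE y in N. section_measure M S (\<beta> g y) = section_measure M S y"
    if "g \<in> set_pmf \<mu>" for g
  proof (rule stationary_harmonic_AE_invariant[OF stat _ borel_measurable_section_measure[OF S] _
        square_integrable section_measure_harmonic[OF \<mu> space] that])
    show "\<beta> h \<in> N \<rightarrow>\<^sub>M N" if "h \<in> set_pmf \<mu>" for h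
      using that \<mu> by (auto simp: measured_group_def intro: measurable_action_measurable[OF actN])
  qed (simp add: section_measure_def)
  have "AE y in N. section_measure M S (\<beta> g y) = section_measure M S y" if "g \<in> carrier G" for g
    using \<mu> that by (intro AE_invariant_semigroup_generated[OF pres _ support])
      (auto simp: measured_group_def)
  then show ?thesis using \<mu> by (simp add: AE_ball_countable measured_group_def)
qed

lemma section_measure_zero_one:
  assumes boundary: "poisson_boundary G \<mu> M \<alpha>" and y: "y \<in> space N"
    and "\<And>g. g \<in> carrier G \<Longrightarrow> section_measure M S (\<beta> g y) = section_measure M S y"
  shows "section_measure M S y = 0 \<or> section_measure M S y = 1"
  using boundary sets_Pair2[OF S, of y]
  by (rule poisson_boundary_indicator_constant)
    (simp add: poisson_transform_indicator_section[OF _ y] assms(3))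

end

section \<open>Ergodicity of products with a Poisson boundary\<close>

lemma poisson_boundary_null_or_conull:
  assumes \<mu>: "measured_group G \<mu>" and boundary: "poisson_boundary G \<mu> M \<alpha>"
    and erg: "ergodic_action G N \<beta>" and stat: "stationary \<mu> N \<beta>"
    and S: "S \<in> sets (M \<Otimes>\<^sub>M N)"
    and invariant: "\<And>g. g \<in> carrier G \<Longrightarrow> prod_action M \<alpha> N \<beta> g ` S = S"
  shows "S \<in> null_sets (M \<Otimes>\<^sub>M N) \<or> space (M \<Otimes>\<^sub>M N) - S \<in> null_sets (M \<Otimes>\<^sub>M N)"
proof -
  have space: "measured_group_space G \<mu> M \<alpha>" and prob: "prob_space M" "prob_space N"
    and pres: "measure_class_preserving G N \<beta>"
    and act: "measurable_action G M \<alpha>" "measurable_action G N \<beta>"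
    using boundary erg
    by (auto simp: poisson_boundary_def ergodic_action_def measure_class_preserving_def)
  interpret M: prob_space M by fact
  interpret N: prob_space N by fact
  interpret pair_prob_space M N ..
  let ?\<Phi> = "section_measure M S"
  have inv: "AE y in N. \<forall>g\<in>carrier G. ?\<Phi> (\<beta> g y) = ?\<Phi> y"
    by (rule section_measure_AE_invariant[OF act S invariant \<mu> space prob(2) pres stat])
  have zero_one: "AE y in N. ?\<Phi> y = 0 \<or> ?\<Phi> y = 1"
    using inv AE_space
    by eventually_elim (rule section_measure_zero_one[OF act S invariant boundary], auto)
  have "Measurable.pred N (\<lambda>y. ?\<Phi> y = 1)"
    using borel_measurable_section_measure[OF S] by measurable
  moreover have "AE y in N. \<forall>g\<in>carrier G. ?\<Phi> (\<beta> g y) = 1 \<longleftrightarrow> ?\<Phi> y = 1"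
    using inv by eventually_elim simp
  moreover have "countable (carrier G)" using \<mu> by (simp add: measured_group_def)
  ultimately consider (conull) "AE y in N. ?\<Phi> y = 1" | (null) "AE y in N. ?\<Phi> y \<noteq> 1"
    using ergodic_action_AE_dichotomy[OF erg] by blast
  then show ?thesis
  proof cases
    case conull
    then have "AE y in N. section_measure M (space (M \<Otimes>\<^sub>M N) - S) y = 0"
      using AE_space by eventually_elim (simp add: section_measure_compl[OF S])
    then show ?thesis using S by (simp add: null_sets_iff_section_measure)
  next
    case null
    then have "AE y in N. ?\<Phi> y = 0"
      using zero_one by eventually_elim simp
    then show ?thesis using S by (simp add: null_sets_iff_section_measure)
  qed
qed

theorem ergodic_action_poisson_boundary_prod:
  assumes "measured_group G \<mu>" and boundary: "poisson_boundary G \<mu> M \<alpha>"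
    and erg: "ergodic_action G N \<beta>" and "stationary \<mu> N \<beta>"
  shows "ergodic_action G (M \<Otimes>\<^sub>M N) (prod_action M \<alpha> N \<beta>)"
proof -
  have pres: "measure_class_preserving G M \<alpha>" "measure_class_preserving G N \<beta>"
    and "prob_space M" "prob_space N"
    using boundary erg by (auto simp: poisson_boundary_def ergodic_action_def)
  interpret M: prob_space M by fact
  interpret N: prob_space N by fact
  interpret P: pair_prob_space M N ..
  have "measure_class_preserving G (M \<Otimes>\<^sub>M N) (prod_action M \<alpha> N \<beta>)"
    using M.sigma_finite_measure_axioms N.sigma_finite_measure_axioms pres
    by (rule measure_class_preserving_prod_action)
  then show ?thesis
    using P.prob_space_axioms poisson_boundary_null_or_conull[OF assms]
    by (auto simp: ergodic_action_def)
qed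

theorem theorem2p1:
  fixes G :: "('g, 'z) monoid_scheme" and \<mu> :: "'g pmf"
    and m :: "'b measure" and \<alpha> :: "'g \<Rightarrow> 'b \<Rightarrow> 'b"
    and m' :: "'c measure" and \<beta> :: "'g \<Rightarrow> 'c \<Rightarrow> 'c"
    and \<eta> :: "'y measure" and \<gamma> :: "'g \<Rightarrow> 'y \<Rightarrow> 'y"
  assumes "measured_group G \<mu>"
    and "poisson_boundary G \<mu> m \<alpha>"
    and "poisson_boundary G (reflected_pmf G \<mu>) m' \<beta>"
    and "pmp_space G \<eta> \<gamma>" and "ergodic_action G \<eta> \<gamma>"
  shows "ergodic_action G (m \<Otimes>\<^sub>M m' \<Otimes>\<^sub>M \<eta>) (diagonal_action m \<alpha> m' \<beta> \<eta> \<gamma>)"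
proof -
  have reflected: "measured_group G (reflected_pmf G \<mu>)"
    using assms(1) by (rule measured_group_reflected_pmf)
  have sigma_finite: "sigma_finite_measure m'" "sigma_finite_measure \<eta>"
    and space: "measured_group_space G (reflected_pmf G \<mu>) m' \<beta>"
    and act: "measurable_action G m' \<beta>" and pres: "measure_preserving_action G \<eta> \<gamma>"
    using assms(3,4) by (auto simp: poisson_boundary_def measured_group_space_def pmp_space_def
        measure_class_preserving_def prob_space_imp_sigma_finite)
  have support: "set_pmf \<mu> \<subseteq> carrier G" "set_pmf (reflected_pmf G \<mu>) \<subseteq> carrier G"
    using assms(1) reflected by (auto simp: measured_group_def)
  have "stationary (reflected_pmf G \<mu>) \<eta> \<gamma>"
    using pres support(2) by (rule measure_preserving_action_imp_stationary)
  with reflected assms(3,5) have "ergodic_action G (m' \<Otimes>\<^sub>M \<eta>) (prod_action m' \<beta> \<eta> \<gamma>)"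
    by (rule ergodic_action_poisson_boundary_prod)
  moreover have "stationary \<mu> m' \<beta>"
    using measured_group_space_imp_stationary[OF reflected space]
    by (simp add: reflected_pmf_reflected_pmf[OF assms(1)])
  then have "stationary \<mu> (m' \<Otimes>\<^sub>M \<eta>) (prod_action m' \<beta> \<eta> \<gamma>)"
    using sigma_finite support(1) act pres by (intro stationary_prod_action)
  ultimately show ?thesis
    unfolding diagonal_action_eq_prod_action
    by (rule ergodic_action_poisson_boundary_prod[OF assms(1,2)])
qed

end
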